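(* Let $\mathbb{Q}(x_1,x_2)$ be the field of rational functions in two independent variables, and let $(x_m)_{m\in\mathbb{Z}}$ be the family of elements of $\mathbb{Q}(x_1,x_2)$ whose terms with $m=1,2$ are the variables $x_1,x_2$ and which satisfies $x_{m-1}x_{m+1}=x_m^2+1$ for all $m\in\mathbb{Z}$. Then for all $n\ge 0$, $$x_{-n} = x_1^{-n} x_2^{-n-1} \left(x_1^{2(n+1)} + \sum_{q + r \leq n} \binom{n+1-r}{q}\binom{n-q}{r} x_1^{2q} x_2^{2r}\right),$$ $$x_{n+3} = x_1^{-n-1} x_2^{-n} \left(x_2^{2(n+1)} + \sum_{q + r \leq n} \binom{n-r}{q}\binom{n+1-q}{r} x_1^{2q} x_2^{2r}\right),$$ where the sums run over all pairs of nonnegative integers $(q,r)$ with $q+r\le n$.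
   Context: The elements $x_m$ ($m\in\mathbb{Z}$) are the cluster variables of the coefficient-free rank 2 cluster algebra with initial cluster $\{x_1,x_2\}$ and initial exchange matrix $\begin{pmatrix}0&2\\-2&0\end{pmatrix}$; they are uniquely determined by the stated recursion (used in both directions) from $x_1,x_2$. *)

theory Defs
  imports "HOL-Computational_Algebra.Computational_Algebra"
begin

text \<open>
  The field $Q(x_1,x_2)$ is the fraction field of $Q[x_1][x_2]$: the inner polynomial layer is
  in \<open>x\<^sub>1\<close>, the outer one in \<open>x\<^sub>2\<close>.
\<close>

type_synonym ratfun2 = "rat poly poly fract"

definition X1 :: ratfun2 where
  "X1 = to_fract [:[:0, 1:]:]"

definition X2 :: ratfun2 where
  "X2 = to_fract [:0, 1:]"

definition is_cluster_family :: "(int \<Rightarrow> ratfun2) \<Rightarrow> bool" where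
  "is_cluster_family x \<longleftrightarrow>
     x 1 = X1 \<and> x 2 = X2 \<and> (\<forall>m. x (m - 1) * x (m + 1) = (x m)\<^sup>2 + 1)"

text \<open>
  The family exists and is unique. Every quotient in the recursion is defined because
  \<^typ>\<open>ratfun2\<close> is an ordered field, so that $x_m^2 + 1$ is never zero.
\<close>

lemma X1_nonzero: "X1 \<noteq> 0" and X2_nonzero: "X2 \<noteq> 0"
  by (simp_all add: X1_def X2_def)

fun two_sided_rec :: "ratfun2 \<Rightarrow> ratfun2 \<Rightarrow> nat \<Rightarrow> ratfun2" where
  "two_sided_rec a b 0 = a"
| "two_sided_rec a b (Suc 0) = b"
| "two_sided_rec a b (Suc (Suc n)) =
     ((two_sided_rec a b (Suc n))\<^sup>2 + 1) / two_sided_rec a b n"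

lemma sq_plus_one_nonzero: "(y :: ratfun2)\<^sup>2 + 1 \<noteq> 0"
  by (metis add_nonneg_pos less_irrefl zero_le_power2 zero_less_one)

lemma two_sided_rec_nonzero:
  "a \<noteq> 0 \<Longrightarrow> b \<noteq> 0 \<Longrightarrow> two_sided_rec a b n \<noteq> 0"
  by (induction a b n rule: two_sided_rec.induct) (auto simp: sq_plus_one_nonzero)

lemma is_cluster_family_exists: "\<exists>x. is_cluster_family x"
proof -
  define f where "f = two_sided_rec X1 X2"
  define g where "g = two_sided_rec X2 X1"
  define x where "x m = (if m \<ge> 1 then f (nat (m - 1)) else g (nat (2 - m)))" for m :: int
  have nz: "f n \<noteq> 0" "g n \<noteq> 0" for n
    by (simp_all add: f_def g_def two_sided_rec_nonzero X1_nonzero X2_nonzero)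
  have f: "f n * f (Suc (Suc n)) = (f (Suc n))\<^sup>2 + 1" for n
    using nz(1)[of n] by (simp add: f_def)
  have g: "g n * g (Suc (Suc n)) = (g (Suc n))\<^sup>2 + 1" for n
    using nz(2)[of n] by (simp add: g_def)
  have xf: "x (int n + 1) = f n" for n
    by (simp add: x_def)
  have xg: "x (2 - int n) = g n" for n
  proof (cases "n \<le> 1")
    case True
    then have "n = 0 \<or> n = 1" by auto
    then show ?thesis by (auto simp: x_def f_def g_def)
  next
    case False
    then show ?thesis by (simp add: x_def)
  qed
  have "x (m - 1) * x (m + 1) = (x m)\<^sup>2 + 1" for m
  proof (cases "m \<ge> 2")
    case True
    define n where "n = nat (m - 2)"
    have "m - 1 = int n + 1" "m = int (Suc n) + 1" "m + 1 = int (Suc (Suc n)) + 1"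
      using True by (auto simp: n_def)
    then show ?thesis using f[of n] xf by metis
  next
    case False
    define n where "n = nat (1 - m)"
    have "m + 1 = 2 - int n" "m = 2 - int (Suc n)" "m - 1 = 2 - int (Suc (Suc n))"
      using False by (auto simp: n_def)
    then show ?thesis using g[of n] xg by (metis mult.commute)
  qed
  moreover have "x 1 = X1" "x 2 = X2"
    using xf[of 0] xg[of 0] by (auto simp: f_def g_def)
  ultimately show ?thesis unfolding is_cluster_family_def by blast
qed

lemma is_cluster_family_nonzero: "is_cluster_family x \<Longrightarrow> x m \<noteq> 0"
  unfolding is_cluster_family_def
  by (metis add_diff_cancel_right' mult_zero_left sq_plus_one_nonzero)

lemma is_cluster_family_unique:
  assumes x: "is_cluster_family x" and y: "is_cluster_family y"
  shows "x = y"
proof -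
  have rec: "z (m - 1) * z (m + 1) = (z m)\<^sup>2 + 1" if "is_cluster_family z" for z m
    using that by (simp add: is_cluster_family_def)
  have step: "x (m + 1) = y (m + 1)" if "x (m - 1) = y (m - 1)" "x m = y m" for m
    using that rec[OF x, of m] rec[OF y, of m] is_cluster_family_nonzero[OF x, of "m - 1"]
    by (metis mult_left_cancel)
  have step': "x (m - 1) = y (m - 1)" if "x (m + 1) = y (m + 1)" "x m = y m" for m
    using that rec[OF x, of m] rec[OF y, of m] is_cluster_family_nonzero[OF x, of "m + 1"]
    by (metis mult_right_cancel)
  have init: "x 1 = y 1" "x 2 = y 2"
    using x y by (simp_all add: is_cluster_family_def)
  have "x (m - 1) = y (m - 1) \<and> x m = y m" for m
  proof (induction m rule: int_induct[where k = 2])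
    case base
    then show ?case using init by simp
  next
    case (step1 i)
    then show ?case using step[of i] by simp
  next
    case (step2 i)
    then show ?case using step'[of "i - 1"] by simp
  qed
  then show ?thesis by blast
qed

end

theory Submission
  imports Defs
begin

text \<open>
  The recursion \<open>x\<^bsub>m-1\<^esub> x\<^bsub>m+1\<^esub> = x\<^sub>m\<^sup>2 + 1\<close> is nonlinear, but it conserves the quantity
  \<open>T = (x\<^bsub>m-1\<^esub> + x\<^bsub>m+1\<^esub>) / x\<^sub>m\<close>, as subtracting two consecutive instances of it shows. Evaluated
  at the initial cluster, \<open>T = (x\<^sub>1\<^sup>2 + x\<^sub>2\<^sup>2 + 1) / (x\<^sub>1 x\<^sub>2)\<close>, so the cluster variables satisfy the
  linear recurrence \<open>x\<^bsub>m+1\<^esub> + x\<^bsub>m-1\<^esub> = T x\<^sub>m\<close> (lemma \<open>exchange_linear\<close>).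

  Write \<open>a = x\<^sub>1\<^sup>2\<close>, \<open>b = x\<^sub>2\<^sup>2\<close>. After clearing denominators, the linear recurrence says that the
  numerators \<open>Q\<^sub>n\<close> of the variables \<open>x\<^bsub>-n\<^esub>\<close> satisfy \<open>Q\<^bsub>n+2\<^esub> + a b Q\<^sub>n = (a + b + 1) Q\<^bsub>n+1\<^esub>\<close>. The
  claimed polynomials satisfy the same recurrence: comparing coefficients of \<open>a\<^sup>q b\<^sup>r\<close>, this is an
  identity between products of two binomial coefficients that follows from Pascal's rule
  (lemmas \<open>coef_rec\<close> and \<open>numer_rec\<close>).

  The recursion is invariant under the reflection \<open>m \<mapsto> 3 - m\<close>, which exchanges the two initial
  variables. Hence the whole argument is carried out for a sequence indexed by natural numbers that
  runs in one direction only, and both formulas are instances of the result (lemma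
  \<open>exchange_formula\<close>).
\<close>

section \<open>The numerator polynomials\<close>

text \<open>
  Truncated subtraction is what makes this uniform: for \<open>q + r > n\<close> the only nonzero value is
  \<open>coef n (n + 1) 0 = 1\<close>, so the isolated leading monomial \<open>a\<^bsup>n+1\<^esup>\<close> of the numerator is the
  coefficient at \<open>(n + 1, 0)\<close> and needs no separate treatment (see \<open>numer_eq_triangle\<close>).
\<close>

definition coef :: "nat \<Rightarrow> nat \<Rightarrow> nat \<Rightarrow> nat" where
  "coef n q r = ((n + 1 - r) choose q) * ((n - q) choose r)"

lemma coef_eq_0: "coef n q r = 0" if "n < q + r" "\<not> (q = n + 1 \<and> r = 0)"
  using that by (cases "q \<le> n") (auto simp: coef_def)

text \<open>
  With \<open>A = n + 1 - r\<close> and \<open>B = n - q\<close>, the five products involve only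
  \<open>A choose q\<close>, \<open>A choose (q + 1)\<close>, \<open>B choose r\<close>, \<open>B choose (r + 1)\<close> and their sums given by
  Pascal's rule. If \<open>q > n\<close> or \<open>r > n + 1\<close>, some subtraction is truncated and this argument
  breaks down; but then all five terms vanish, except that for \<open>q = n + 1\<close>, \<open>r = 0\<close> the isolated
  coefficient \<open>1\<close> appears once on each side.
\<close>

lemma coef_rec:
  "coef (n + 2) (Suc q) (Suc r) + coef n q r =
     coef (n + 1) q (Suc r) + coef (n + 1) (Suc q) r + coef (n + 1) (Suc q) (Suc r)"
proof (cases "q \<le> n \<and> r \<le> n + 1")
  case True
  define A B where "A = n + 1 - r" and "B = n - q"
  have "n + 2 + 1 - Suc r = Suc A" "n + 2 - Suc q = Suc B" "n + 1 + 1 - Suc r = A"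
    "n + 1 - q = Suc B" "n + 1 + 1 - r = Suc A" "n + 1 - Suc q = B"
    "n + 1 - r = A" "n - q = B"
    using True by (auto simp: A_def B_def)
  then show ?thesis
    unfolding coef_def by (simp add: algebra_simps)
next
  case False
  show ?thesis
  proof (cases "q = n + 1 \<and> r = 0")
    case True
    then show ?thesis by (simp add: coef_def)
  next
    case False
    with \<open>\<not> (q \<le> n \<and> r \<le> n + 1)\<close> show ?thesis
      by (subst (1 2 3 4 5) coef_eq_0) auto
  qed
qed

text \<open>
  A generating polynomial in \<open>a\<close> and \<open>b\<close>, truncated to degree at most \<open>N\<close> in each variable. Keeping
  the bound separate from the coefficients lets several of these polynomials be compared over one
  common range.
\<close>

definition box_poly :: "'a::comm_ring_1 \<Rightarrow> 'a \<Rightarrow> nat \<Rightarrow> (nat \<Rightarrow> nat \<Rightarrow> nat) \<Rightarrow> 'a" where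
  "box_poly a b N f = (\<Sum>q\<le>N. \<Sum>r\<le>N. of_nat (f q r) * a ^ q * b ^ r)"

definition shift_fst :: "(nat \<Rightarrow> nat \<Rightarrow> nat) \<Rightarrow> nat \<Rightarrow> nat \<Rightarrow> nat" where
  "shift_fst f q r = (case q of 0 \<Rightarrow> 0 | Suc p \<Rightarrow> f p r)"

definition shift_snd :: "(nat \<Rightarrow> nat \<Rightarrow> nat) \<Rightarrow> nat \<Rightarrow> nat \<Rightarrow> nat" where
  "shift_snd f q r = (case r of 0 \<Rightarrow> 0 | Suc s \<Rightarrow> f q s)"

lemma box_poly_add:
  "box_poly a b N (\<lambda>q r. f q r + g q r) = box_poly a b N f + box_poly a b N g"
  by (simp add: box_poly_def sum.distrib algebra_simps)

lemma sum_shift: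
  fixes g :: "nat \<Rightarrow> 'a::comm_monoid_add"
  assumes "h 0 = 0" "\<And>q. h (Suc q) = g q" "g N = 0"
  shows "(\<Sum>q\<le>N. h q) = (\<Sum>q\<le>N. g q)"
proof -
  have "(\<Sum>q\<le>Suc N. h q) = (\<Sum>q\<le>N. g q)"
    by (simp only: sum.atMost_Suc_shift assms add_0)
  then show ?thesis using assms by simp
qed

lemma box_poly_shift_fst:
  assumes "\<And>r. f N r = 0"
  shows "box_poly a b N (shift_fst f) = a * box_poly a b N f"
proof -
  have "box_poly a b N (shift_fst f) = (\<Sum>q\<le>N. \<Sum>r\<le>N. a * (of_nat (f q r) * a ^ q * b ^ r))"
    unfolding box_poly_def
    by (rule sum_shift) (auto simp: shift_fst_def assms intro!: sum.cong)
  then show ?thesis by (simp add: box_poly_def sum_distrib_left)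
qed

lemma box_poly_shift_snd:
  assumes "\<And>q. f q N = 0"
  shows "box_poly a b N (shift_snd f) = b * box_poly a b N f"
proof -
  have "box_poly a b N (shift_snd f) = (\<Sum>q\<le>N. \<Sum>r\<le>N. b * (of_nat (f q r) * a ^ q * b ^ r))"
    unfolding box_poly_def
    by (intro sum.cong refl sum_shift) (auto simp: shift_snd_def assms)
  then show ?thesis by (simp add: box_poly_def sum_distrib_left)
qed

definition numer :: "'a::comm_ring_1 \<Rightarrow> 'a \<Rightarrow> nat \<Rightarrow> 'a" where
  "numer a b n = a ^ (n + 1) + (\<Sum>(q, r) \<in> {(q, r). q + r \<le> n}.
     of_nat ((n + 1 - r) choose q) * of_nat ((n - q) choose r) * a ^ q * b ^ r)"

lemma finite_triangle: "finite {(q, r). q + r \<le> (n::nat)}"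
  by (rule finite_subset[of _ "{..n} \<times> {..n}"]) auto

lemma numer_eq_triangle:
  assumes "n < N"
  shows "box_poly a b N (coef n) = numer a b n"
proof -
  let ?t = "\<lambda>(q, r). of_nat (coef n q r) * a ^ q * b ^ r"
  let ?T = "{(q, r). q + r \<le> n}"
  have nonzero: "q = n + 1 \<and> r = 0" if "of_nat (coef n q r) * a ^ q * b ^ r \<noteq> 0" "\<not> q + r \<le> n"
    for q r
  proof -
    have "coef n q r \<noteq> 0" using that(1) by (rule contrapos_nn) simp
    then show ?thesis using coef_eq_0[of n q r] that(2) by (auto simp only: not_le)
  qed
  have "box_poly a b N (coef n) = sum ?t ({..N} \<times> {..N})"
    by (simp add: box_poly_def sum.cartesian_product)
  also have "\<dots> = sum ?t (insert (n + 1, 0) ?T)"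
    using assms by (intro sum.mono_neutral_right) (auto dest: nonzero)
  also have "\<dots> = ?t (n + 1, 0) + sum ?t ?T"
    by (rule sum.insert) (auto simp: finite_triangle)
  finally show ?thesis by (simp add: numer_def coef_def)
qed

text \<open>
  Multiplying by \<open>a\<close> or \<open>b\<close> shifts the coefficients, so this is \<open>coef_rec\<close> summed against
  \<open>a\<^sup>q b\<^sup>r\<close>, completed by the two edges \<open>q = 0\<close> and \<open>r = 0\<close>, where it is Pascal's rule for a single
  binomial coefficient.
\<close>

lemma numer_rec:
  "numer a b (n + 2) + a * b * numer a b n = (a + b + 1) * numer a b (n + 1)"
proof -
  have pointwise: "coef (n + 2) q r + shift_fst (shift_snd (coef n)) q r =
      (shift_fst (coef (n + 1)) q r + shift_snd (coef (n + 1)) q r) + coef (n + 1) q r" for q r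
    using coef_rec[of n "q - 1" "r - 1"]
    by (cases q; cases r) (simp_all add: shift_fst_def shift_snd_def coef_def)
  \<comment> \<open>No monomial, shifted ones included, has an exponent above \<open>n + 3\<close>.\<close>
  define N where "N = n + 3"
  have vanish: "coef m N r = 0" "coef m r N = 0" if "m \<le> n + 1" for m r
    using that by (auto simp: N_def intro!: coef_eq_0)
  have vanish': "shift_snd (coef n) N r = 0" for r
    by (cases r) (simp_all add: shift_snd_def vanish)
  have "box_poly a b N (coef (n + 2)) + box_poly a b N (shift_fst (shift_snd (coef n))) =
      box_poly a b N (shift_fst (coef (n + 1))) + box_poly a b N (shift_snd (coef (n + 1)))
        + box_poly a b N (coef (n + 1))"
    by (simp only: box_poly_add[symmetric] pointwise)
  then have "box_poly a b N (coef (n + 2)) + a * (b * box_poly a b N (coef n)) =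
      a * box_poly a b N (coef (n + 1)) + b * box_poly a b N (coef (n + 1))
        + box_poly a b N (coef (n + 1))"
    by (simp add: box_poly_shift_fst box_poly_shift_snd vanish vanish')
  then show ?thesis
    by (simp add: numer_eq_triangle N_def algebra_simps)
qed

lemma numer_0: "numer a b 0 = a + 1"
proof -
  have "{(q, r). q + r \<le> (0::nat)} = {(0, 0)}" by auto
  then show ?thesis by (simp add: numer_def)
qed

lemma numer_1: "numer a b 1 = a ^ 2 + 2 * a + b + 1"
proof -
  have "{(q, r). q + r \<le> (1::nat)} = {(0, 0), (1, 0), (0, 1)}" by auto
  then show ?thesis by (simp add: numer_def algebra_simps power2_eq_square)
qed

section \<open>One-sided solutions of the exchange recursion\<close>

text \<open>
  The conserved quantity: adding \<open>y\<^bsub>n+1\<^esub>\<^sup>2\<close> to the instance of the recursion for \<open>y\<^bsub>n+3\<^esub>\<close> and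
  rewriting \<open>y\<^bsub>n+1\<^esub>\<^sup>2 + 1\<close> as \<open>y\<^sub>n y\<^bsub>n+2\<^esub>\<close> gives
  \<open>y\<^bsub>n+1\<^esub> (y\<^bsub>n+3\<^esub> + y\<^bsub>n+1\<^esub>) = y\<^bsub>n+2\<^esub> (y\<^bsub>n+2\<^esub> + y\<^sub>n)\<close>.
\<close>

lemma exchange_linear:
  fixes y :: "nat \<Rightarrow> 'a::field"
  assumes nz: "\<And>n. y n \<noteq> 0"
    and rec: "\<And>n. y n * y (n + 2) = (y (n + 1))\<^sup>2 + 1"
  shows "y 0 * y 1 * (y (n + 2) + y n) = ((y 1)\<^sup>2 + (y 0)\<^sup>2 + 1) * y (n + 1)"
proof (induction n)
  case 0
  have "y 0 * y 2 = (y 1)\<^sup>2 + 1" using rec[of 0] by (simp add: numeral_eq_Suc)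
  then have "y 0 * y 1 * (y 2 + y 0) = ((y 1)\<^sup>2 + (y 0)\<^sup>2 + 1) * y 1" by algebra
  then show ?case by (simp add: numeral_eq_Suc)
next
  case (Suc n)
  have "y (n + 1) * y (n + 3) = (y (n + 2))\<^sup>2 + 1"
    using rec[of "n + 1"] by (simp add: numeral_eq_Suc)
  with rec[of n] Suc.IH
  have "y (n + 1) * (y 0 * y 1 * (y (n + 3) + y (n + 1))) =
      y (n + 1) * (((y 1)\<^sup>2 + (y 0)\<^sup>2 + 1) * y (n + 2))"
    by algebra
  then show ?case using nz[of "n + 1"] by (simp add: numeral_eq_Suc)
qed

text \<open>
  The translation of the linear recurrence into the one for numerators, where \<open>p\<close> and \<open>q\<close> stand
  for \<open>u\<^sup>n\<close> and \<open>v\<^sup>n\<close>: it is multiplied by \<open>p q u v\<^sup>2\<close>.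
\<close>

lemma clear_denominators:
  fixes u v :: "'a::field"
  assumes "v * u * (y2 + y0) = (u\<^sup>2 + v\<^sup>2 + 1) * y1"
    and "y0 * (p * (q * v)) = Q0"
    and "y1 * (u * p * (q * v * v)) = Q1"
    and "Q2 + u\<^sup>2 * v\<^sup>2 * Q0 = (u\<^sup>2 + v\<^sup>2 + 1) * Q1"
  shows "y2 * (u * u * p * (q * v * v * v)) = Q2"
proof -
  have "Q2 = (u\<^sup>2 + v\<^sup>2 + 1) * y1 * (u * p * (q * v * v)) - u\<^sup>2 * v\<^sup>2 * (y0 * (p * (q * v)))"
    using assms(4) unfolding assms(2,3)[symmetric] by (simp add: algebra_simps)
  also have "\<dots> = v * u * (y2 + y0) * (u * p * (q * v * v)) - u\<^sup>2 * v\<^sup>2 * (y0 * (p * (q * v)))"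
    unfolding assms(1) ..
  also have "\<dots> = y2 * (u * u * p * (q * v * v * v))"
    by (simp add: algebra_simps power2_eq_square)
  finally show ?thesis ..
qed

lemma exchange_numer:
  fixes y :: "nat \<Rightarrow> 'a::field"
  assumes nz: "\<And>n. y n \<noteq> 0"
    and rec: "\<And>n. y n * y (n + 2) = (y (n + 1))\<^sup>2 + 1"
  shows "y (n + 2) * (y 1 ^ n * y 0 ^ (n + 1)) = numer ((y 1)\<^sup>2) ((y 0)\<^sup>2) n"
proof -
  note lin = exchange_linear[of y, OF nz rec]
  let ?Q = "numer ((y 1)\<^sup>2) ((y 0)\<^sup>2)"
  have y2: "y 0 * y 2 = (y 1)\<^sup>2 + 1" using rec[of 0] by (simp add: numeral_eq_Suc)
  show ?thesis
  proof (induction n rule: induct_nat_012)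
    case 0
    show ?case using y2 by (simp add: numer_0 numeral_eq_Suc mult.commute)
  next
    case 1
    have "y 0 * y 1 * (y 3 + y 1) = ((y 1)\<^sup>2 + (y 0)\<^sup>2 + 1) * y 2"
      using lin[of 1] by (simp add: numeral_eq_Suc)
    with y2 have "y 3 * (y 1 * (y 0)\<^sup>2) = ((y 1)\<^sup>2)\<^sup>2 + 2 * (y 1)\<^sup>2 + (y 0)\<^sup>2 + 1"
      by algebra
    then show ?case using numer_1[of "(y 1)\<^sup>2" "(y 0)\<^sup>2"] by (simp add: numeral_eq_Suc)
  next
    case (ge2 n)
    have "y 0 * y 1 * (y (n + 4) + y (n + 2)) = ((y 1)\<^sup>2 + (y 0)\<^sup>2 + 1) * y (n + 3)"
      using lin[of "n + 2"] by (simp add: numeral_eq_Suc)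
    moreover have "y (n + 2) * (y 1 ^ n * (y 0 ^ n * y 0)) = ?Q n"
      using ge2(1) by (simp add: mult_ac)
    moreover have "y (n + 3) * (y 1 * y 1 ^ n * (y 0 ^ n * y 0 * y 0)) = ?Q (n + 1)"
      using ge2(2) by (simp add: numeral_eq_Suc mult_ac)
    moreover have "?Q (n + 2) + (y 1)\<^sup>2 * (y 0)\<^sup>2 * ?Q n = ((y 1)\<^sup>2 + (y 0)\<^sup>2 + 1) * ?Q (n + 1)"
      by (rule numer_rec)
    ultimately have "y (n + 4) * (y 1 * y 1 * y 1 ^ n * (y 0 ^ n * y 0 * y 0 * y 0)) = ?Q (n + 2)"
      by (rule clear_denominators)
    then show ?case by (simp add: numeral_eq_Suc mult_ac)
  qed
qed

lemma exchange_formula: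
  fixes y :: "nat \<Rightarrow> 'a::field"
  assumes nz: "\<And>n. y n \<noteq> 0"
    and rec: "\<And>n. y n * y (n + 2) = (y (n + 1))\<^sup>2 + 1"
  shows "y (n + 2) = y 1 powi (- int n) * y 0 powi (- int n - 1) *
           (y 1 ^ (2 * (n + 1)) +
            (\<Sum>(q, r) \<in> {(q, r). q + r \<le> n}.
               of_nat ((n + 1 - r) choose q) * of_nat ((n - q) choose r)
                 * y 1 ^ (2 * q) * y 0 ^ (2 * r)))"
proof -
  have "y 1 powi (- int n) = inverse (y 1 ^ n)"
    by (simp add: power_int_minus)
  moreover have "y 0 powi (- int n - 1) = inverse (y 0 ^ (n + 1))"
  proof -
    have "- int n - 1 = - int (n + 1)" by simp
    then show ?thesis by (metis power_int_minus power_int_of_nat)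
  qed
  moreover have "y (n + 2) = inverse (y 1 ^ n) * inverse (y 0 ^ (n + 1)) *
      numer ((y 1)\<^sup>2) ((y 0)\<^sup>2) n"
    unfolding exchange_numer[of y, OF nz rec, symmetric] using nz by (simp add: field_simps)
  ultimately show ?thesis
    by (simp add: numer_def power_mult power2_eq_square)
qed

section \<open>The cluster variables\<close>

theorem theorem4p1:
  fixes x :: "int \<Rightarrow> ratfun2" and n :: nat
  assumes "is_cluster_family x"
  shows "x (- int n) =
           X1 powi (- int n) * X2 powi (- int n - 1) *
           (X1 ^ (2 * (n + 1)) +
            (\<Sum>(q, r) \<in> {(q, r). q + r \<le> n}.
               of_nat ((n + 1 - r) choose q) * of_nat ((n - q) choose r)
                 * X1 ^ (2 * q) * X2 ^ (2 * r))) \<and>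
         x (int n + 3) =
           X1 powi (- int n - 1) * X2 powi (- int n) *
           (X2 ^ (2 * (n + 1)) +
            (\<Sum>(q, r) \<in> {(q, r). q + r \<le> n}.
               of_nat ((n - r) choose q) * of_nat ((n + 1 - q) choose r)
                 * X1 ^ (2 * q) * X2 ^ (2 * r)))"
proof (intro conjI)
  have nz: "x m \<noteq> 0" for m
    using assms by (rule is_cluster_family_nonzero)
  have x12: "x 1 = X1" "x 2 = X2"
    and rec: "x (m - 1) * x (m + 1) = (x m)\<^sup>2 + 1" for m
    using assms by (auto simp: is_cluster_family_def)
  show "x (- int n) =
           X1 powi (- int n) * X2 powi (- int n - 1) *
           (X1 ^ (2 * (n + 1)) +
            (\<Sum>(q, r) \<in> {(q, r). q + r \<le> n}.
               of_nat ((n + 1 - r) choose q) * of_nat ((n - q) choose r)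
                 * X1 ^ (2 * q) * X2 ^ (2 * r)))"
  proof -
    have "x (2 - int k) * x (2 - int (k + 2)) = (x (2 - int (k + 1)))\<^sup>2 + 1" for k
      using rec[of "1 - int k"] by (simp add: algebra_simps)
    then show ?thesis
      using exchange_formula[of "\<lambda>k. x (2 - int k)" n] nz x12 by simp
  qed
  show "x (int n + 3) =
           X1 powi (- int n - 1) * X2 powi (- int n) *
           (X2 ^ (2 * (n + 1)) +
            (\<Sum>(q, r) \<in> {(q, r). q + r \<le> n}.
               of_nat ((n - r) choose q) * of_nat ((n + 1 - q) choose r)
                 * X1 ^ (2 * q) * X2 ^ (2 * r)))"
  proof -
    have "x (1 + int k) * x (1 + int (k + 2)) = (x (1 + int (k + 1)))\<^sup>2 + 1" for k
      using rec[of "2 + int k"] by (simp add: algebra_simps)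
    then have "x (int n + 3) =
           X2 powi (- int n) * X1 powi (- int n - 1) *
           (X2 ^ (2 * (n + 1)) +
            (\<Sum>(q, r) \<in> {(q, r). q + r \<le> n}.
               of_nat ((n + 1 - r) choose q) * of_nat ((n - q) choose r)
                 * X2 ^ (2 * q) * X1 ^ (2 * r)))"
      using exchange_formula[of "\<lambda>k. x (1 + int k)" n] nz x12 by (simp add: add.commute)
    \<comment> \<open>The roles of the two variables are exchanged, so the summation indices have to be too.\<close>
    also have "(\<Sum>(q, r) \<in> {(q, r). q + r \<le> n}.
               of_nat ((n + 1 - r) choose q) * of_nat ((n - q) choose r)
                 * X2 ^ (2 * q) * X1 ^ (2 * r)) =
            (\<Sum>(q, r) \<in> {(q, r). q + r \<le> n}.
               of_nat ((n - r) choose q) * of_nat ((n + 1 - q) choose r)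
                 * X1 ^ (2 * q) * X2 ^ (2 * r))"
      by (rule sum.reindex_bij_witness[of _ prod.swap prod.swap]) (auto simp: mult_ac)
    finally show ?thesis by (simp only: mult_ac)
  qed
qed

end
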